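(* Let $r$ and $d$ be positive integers with $r\ge d+2$, and let $s$ be a sufficiently large integer relative to $r$ and $d$. Then there exists a constant $c_{r,d}>0$ (depending only on $r,d$) such that \[ F_r(d,s,\ldots,s)\le c_{r,d}\cdot\min\Big\{s^{\left(1-\frac{1}{2^{d}(d+1)}\right)r+\frac{1}{2^d}},\ s^{2d+3-2^{-r}}\Big\}\cdot\log s, \] where $s$ is repeated $r$ times.
   Context: For integers $d\ge1$, $r\ge2$, $s_1,\ldots,s_r\ge1$, $F_r(d,s_1,\ldots,s_r)$ is the least integer $n$ such that every $n$-point set $P\subseteq\mathbb{R}^d$ admits a partition $P=P_1\sqcup\cdots\sqcup P_r$ with the property: whenever, for each $i\in[r]$, $C_i=\bigcup_{j=1}^{s_i}C_{i,j}$ with the $C_{i,j}$ convex sets satisfying $C_{i,j}\cap C_{i,j'}=\emptyset$ for $j\ne j'$ and $P_i\subseteq C_i$, then $\bigcap_{i=1}^r C_i\neq\emptyset$. *)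

theory Defs
  imports "HOL-Analysis.Analysis"
begin

definition disjoint_convex_union :: "nat \<Rightarrow> 'a::real_vector set \<Rightarrow> bool" where
  "disjoint_convex_union s C \<longleftrightarrow>
     (\<exists>D. (\<forall>j\<in>{1..s}. convex (D j)) \<and> disjoint_family_on D {1..s} \<and> C = (\<Union>j\<in>{1..s}. D j))"

(* Parts are not required to be nonempty; for positive s i this changes nothing, since an
   empty part Q i could be covered by C i = {}. *)
definition tverberg_partition ::
    "nat \<Rightarrow> (nat \<Rightarrow> nat) \<Rightarrow> 'a::real_vector set \<Rightarrow> (nat \<Rightarrow> 'a set) \<Rightarrow> bool" where
  "tverberg_partition r s P Q \<longleftrightarrow>
     disjoint_family_on Q {1..r} \<and> P = (\<Union>i\<in>{1..r}. Q i) \<and>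
     (\<forall>C. (\<forall>i\<in>{1..r}. disjoint_convex_union (s i) (C i) \<and> Q i \<subseteq> C i)
          \<longrightarrow> (\<Inter>i\<in>{1..r}. C i) \<noteq> {})"

(* F_r(d, s 1, ..., s r), the dimension d = CARD('d) being given by the type argument. The
   value is an extended natural, so that it is infinite, rather than an arbitrary number,
   if no n has the required property; a finite upper bound thus includes existence of n. *)
definition tverberg_number :: "'d::finite itself \<Rightarrow> nat \<Rightarrow> (nat \<Rightarrow> nat) \<Rightarrow> enat" where
  "tverberg_number _ r s =
     Inf {enat n | n. \<forall>P :: (real ^ 'd) set. finite P \<and> card P = n \<longrightarrow>
                        (\<exists>Q. tverberg_partition r s P Q)}"

end

theory Submission
  imports Defs
begin

text \<open>Suppose that no partition of an \<open>n\<close>-point set \<open>P\<close> works. Then every colouring of \<open>P\<close> with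
  \<open>r\<close> colours has convex pieces, at most \<open>s\<close> per colour, such that any choice of one piece per
  colour has empty intersection. By Helly's theorem this is already witnessed by tuples of \<open>d + 1\<close>
  pieces, and the (compact) pieces of such a tuple can be separated by \<open>d + 1\<close> half-spaces with
  empty intersection. So \<open>(d + 1) (r s) ^ (d + 1)\<close> half-spaces certify that the colouring is bad,
  and only their traces on \<open>P\<close> matter, of which there are at most \<open>(n + 1) ^ (d + 1)\<close>. A certificate
  excludes at least one colour at each point, so it serves at most \<open>(r - 1) ^ n\<close> colourings.
  Comparing with \<open>r ^ n\<close> gives \<open>n = O(s ^ (d + 1) log s)\<close>, and both exponents of the theorem are at
  least \<open>d + 1\<close>.\<close>

section \<open>Shattering and traces of half-spaces\<close>

definition shatters :: "'a set set \<Rightarrow> 'a set \<Rightarrow> bool" where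
  "shatters F A \<longleftrightarrow> (\<lambda>S. S \<inter> A) ` F = Pow A"

text \<open>Pajor's strengthening of the Sauer--Shelah lemma.\<close>

lemma card_le_card_shattered:
  assumes "finite P" "F \<subseteq> Pow P"
  shows "card F \<le> card {A. A \<subseteq> P \<and> shatters F A}"
  using assms
proof (induction P arbitrary: F rule: finite_induct)
  case empty
  then have "F = {} \<or> F = {{}}" by auto
  then show ?case
  proof
    assume F: "F = {{}}"
    then have "{A. A \<subseteq> {} \<and> shatters F A} = {{}}"
      by (auto simp: shatters_def)
    then show ?thesis using F by simp
  qed simp
next
  case (insert x P)
  \<comment> \<open>Members avoiding \<open>x\<close>, and members containing \<open>x\<close> with
    \<open>x\<close> removed. A set shattered by both is shattered by \<open>F\<close> with and
    without \<open>x\<close> added, which accounts for the overlap in the count below.\<close>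
  define F0 where "F0 = {S \<in> F. x \<notin> S}"
  define F1 where "F1 = {S. x \<notin> S \<and> insert x S \<in> F}"
  have sub: "F0 \<subseteq> Pow P" "F1 \<subseteq> Pow P"
    using insert.prems by (auto simp: F0_def F1_def)
  have fin: "finite F0" "finite F1"
    using sub insert.hyps(1) by (meson finite_Pow_iff finite_subset)+
  have F: "F = F0 \<union> insert x ` F1"
  proof -
    have "S \<in> insert x ` F1" if "S \<in> F" "x \<in> S" for S
      using that by (intro image_eqI[of _ _ "S - {x}"]) (auto simp: F1_def insert_absorb)
    then show ?thesis by (auto simp: F0_def F1_def)
  qed
  have inj: "inj_on (insert x) F1"
    by (auto simp: inj_on_def F1_def)
  have "card F \<le> card F0 + card F1"
    using card_Un_le[of F0 "insert x ` F1"] card_image[OF inj] by (simp add: F)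
  let ?Sh = "\<lambda>G. {A. A \<subseteq> P \<and> shatters G A}"
  have finSh: "finite (?Sh G)" for G
    by (rule finite_subset[of _ "Pow P"]) (use insert.hyps(1) in auto)
  have shx: "shatters F A" if "A \<subseteq> P" "shatters F0 A \<or> shatters F1 A" for A
  proof -
    have "x \<notin> A" using that insert.hyps(2) by auto
    then have "(\<lambda>S. S \<inter> A) ` insert x ` F1 = (\<lambda>S. S \<inter> A) ` F1"
      by (auto simp: image_image)
    then have "(\<lambda>S. S \<inter> A) ` F = (\<lambda>S. S \<inter> A) ` F0 \<union> (\<lambda>S. S \<inter> A) ` F1"
      by (simp add: F image_Un)
    then show ?thesis using that(2) by (auto simp: shatters_def)
  qed
  have shxx: "shatters F (insert x A)" if A: "A \<subseteq> P" "shatters F0 A" "shatters F1 A" for A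
  proof -
    have xA: "x \<notin> A" using that insert.hyps(2) by auto
    have "B \<in> (\<lambda>S. S \<inter> insert x A) ` F" if B: "B \<subseteq> insert x A" for B
    proof (cases "x \<in> B")
      case True
      have "B - {x} \<in> (\<lambda>S. S \<inter> A) ` F1" using A(3) B by (auto simp: shatters_def)
      then obtain S where S: "S \<in> F1" "S \<inter> A = B - {x}" by auto
      have "insert x S \<in> F" using S by (auto simp: F1_def)
      moreover have "insert x S \<inter> insert x A = B"
        using S(2) xA True by auto
      ultimately show ?thesis by (metis imageI)
    next
      case False
      have "B \<in> (\<lambda>S. S \<inter> A) ` F0" using A(2) B False by (auto simp: shatters_def)
      then obtain S where S: "S \<in> F0" "S \<inter> A = B" by auto
      have "S \<in> F" "S \<inter> insert x A = B" using S by (auto simp: F0_def)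
      then show ?thesis by (metis imageI)
    qed
    then show ?thesis by (auto simp: shatters_def)
  qed
  have "card F0 + card F1 \<le> card (?Sh F0) + card (?Sh F1)"
    using insert.IH[OF sub(1)] insert.IH[OF sub(2)] by simp
  also have "\<dots> = card (?Sh F0 \<union> ?Sh F1) + card (insert x ` (?Sh F0 \<inter> ?Sh F1))"
  proof -
    have "inj_on (insert x) (?Sh F0 \<inter> ?Sh F1)"
      using insert.hyps(2) by (auto simp: inj_on_def)
    then show ?thesis
      by (simp only: card_image card_Un_Int[OF finSh finSh])
  qed
  also have "\<dots> = card ((?Sh F0 \<union> ?Sh F1) \<union> insert x ` (?Sh F0 \<inter> ?Sh F1))"
    by (rule card_Un_disjoint[symmetric]) (use finSh insert.hyps(2) in auto)
  also have "\<dots> \<le> card {A. A \<subseteq> insert x P \<and> shatters F A}"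
    by (intro card_mono) (use insert.hyps(1) shx shxx in auto)
  finally show ?case
    using \<open>card F \<le> card F0 + card F1\<close> by simp
qed

lemma card_subsets_card_le:
  assumes "finite P"
  shows "card {A. A \<subseteq> P \<and> card A \<le> k} \<le> (card P + 1) ^ k"
proof (induction k)
  case 0
  have "{A. A \<subseteq> P \<and> card A \<le> 0} = {{}}"
    using assms by (auto dest: finite_subset)
  then show ?case by simp
next
  case (Suc k)
  let ?N = "\<lambda>k. {A. A \<subseteq> P \<and> card A \<le> k}"
  \<comment> \<open>A set of size at most \<open>Suc k\<close> arises from one of size at most
    \<open>k\<close> by adding nothing (\<open>None\<close>) or one point of \<open>P\<close>, hence
    the factor \<open>card P + 1\<close>.\<close>
  let ?f = "\<lambda>(z, B). case z of None \<Rightarrow> B | Some x \<Rightarrow> insert x B"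
  have fin: "finite (?N k)" for k
    by (rule finite_subset[of _ "Pow P"]) (use assms in auto)
  have "?N (Suc k) \<subseteq> ?f ` (insert None (Some ` P) \<times> ?N k)"
  proof
    fix A assume A: "A \<in> ?N (Suc k)"
    show "A \<in> ?f ` (insert None (Some ` P) \<times> ?N k)"
    proof (cases "A = {}")
      case True
      then show ?thesis by (intro image_eqI[of _ _ "(None, {})"]) auto
    next
      case False
      then obtain x where "x \<in> A" by auto
      moreover have "finite A" using A assms finite_subset by blast
      ultimately show ?thesis
        using A by (intro image_eqI[of _ _ "(Some x, A - {x})"]) (auto simp: insert_absorb)
    qed
  qed
  then have "card (?N (Suc k)) \<le> card (?f ` (insert None (Some ` P) \<times> ?N k))"
    by (intro card_mono) (use fin assms in auto)
  also have "\<dots> \<le> card (insert None (Some ` P) \<times> ?N k)"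
    by (intro card_image_le) (use fin assms in auto)
  also have "\<dots> = (card P + 1) * card (?N k)"
    using assms by (simp add: card_cartesian_product card_insert_if card_image)
  also have "\<dots> \<le> (card P + 1) ^ Suc k"
    using mult_le_mono2[OF Suc.IH, of "card P + 1"] by simp
  finally show ?case .
qed

lemma sauer_shelah:
  assumes "finite P" "F \<subseteq> Pow P" "\<And>A. A \<subseteq> P \<Longrightarrow> shatters F A \<Longrightarrow> card A \<le> k"
  shows "card F \<le> (card P + 1) ^ k"
proof -
  have "card F \<le> card {A. A \<subseteq> P \<and> shatters F A}"
    by (rule card_le_card_shattered[OF assms(1,2)])
  also have "\<dots> \<le> card {A. A \<subseteq> P \<and> card A \<le> k}"
  proof (rule card_mono)
    show "finite {A. A \<subseteq> P \<and> card A \<le> k}"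
      by (rule finite_subset[of _ "Pow P"]) (use assms(1) in auto)
  qed (use assms(3) in auto)
  also have "\<dots> \<le> (card P + 1) ^ k"
    by (rule card_subsets_card_le[OF assms(1)])
  finally show ?thesis .
qed

text \<open>The degenerate case \<open>a = 0\<close> is included on purpose: it makes the empty set and the whole
  space half-spaces as well.\<close>

definition halfspace :: "'a::real_inner \<times> real \<Rightarrow> 'a set" where
  "halfspace h = {x. fst h \<bullet> x \<le> snd h}"

lemma convex_halfspace: "convex (halfspace h)"
  unfolding halfspace_def by (rule convex_halfspace_le)

lemma closed_halfspace: "closed (halfspace h)"
  unfolding halfspace_def by (rule closed_halfspace_le)

definition halfspace_traces :: "'a::real_inner set \<Rightarrow> 'a set set" where
  "halfspace_traces P = range (\<lambda>h. halfspace h \<inter> P)"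

lemma convex_Compl_halfspace: "convex (- halfspace h)"
proof -
  have "- halfspace h = {x. fst h \<bullet> x > snd h}"
    by (auto simp: halfspace_def)
  then show ?thesis by (simp add: convex_halfspace_gt)
qed

text \<open>By Radon's theorem any \<open>DIM('a) + 2\<close> points split into two parts with
  intersecting hulls, and no half-space cuts off exactly one of these parts. So shattered sets have
  at most \<open>DIM('a) + 1\<close> points, and Sauer--Shelah applies.\<close>

lemma card_halfspace_traces:
  fixes P :: "'a::euclidean_space set"
  assumes "finite P"
  shows "card (halfspace_traces P) \<le> (card P + 1) ^ (DIM('a) + 1)"
proof (rule sauer_shelah[OF assms])
  show "halfspace_traces P \<subseteq> Pow P"
    by (auto simp: halfspace_traces_def)
  fix A assume A: "A \<subseteq> P" "shatters (halfspace_traces P) A"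
  show "card A \<le> DIM('a) + 1"
  proof (rule ccontr)
    assume "\<not> card A \<le> DIM('a) + 1"
    moreover have "finite A" using A(1) assms by (rule finite_subset)
    ultimately have "\<exists>M N. M \<inter> N = {} \<and> M \<union> N = A \<and> convex hull M \<inter> convex hull N \<noteq> {}"
      by (intro Radon_partition affine_dependent_biggerset) auto
    then obtain M N where MN: "M \<inter> N = {}" "M \<union> N = A" "convex hull M \<inter> convex hull N \<noteq> {}"
      by blast
    have "M \<in> (\<lambda>S. S \<inter> A) ` halfspace_traces P"
      using A(2) MN(2) by (auto simp: shatters_def)
    then obtain h where h: "M = halfspace h \<inter> P \<inter> A"
      by (auto simp: halfspace_traces_def)
    have "convex hull M \<subseteq> halfspace h"
      by (rule hull_minimal) (use h convex_halfspace[of h] in auto)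
    moreover have "convex hull N \<subseteq> - halfspace h"
      by (rule hull_minimal) (use h A(1) MN convex_Compl_halfspace[of h] in auto)
    ultimately show False using MN(3) by blast
  qed
qed

section \<open>Empty intersections of convex sets\<close>

text \<open>The sets are replaced by half-spaces one at a time. The closed convex set
  \<open>L\<close> makes the induction work: the hypothesis is applied to
  \<open>L \<inter> K i\<close>, then \<open>K i\<close> is separated from \<open>L\<close> cut with
  the half-spaces found. Compactness of \<open>K i\<close> gives strict separation.\<close>

lemma empty_Int_imp_halfspaces:
  fixes K :: "'i \<Rightarrow> 'a::euclidean_space set"
  assumes "finite I" "\<And>i. i \<in> I \<Longrightarrow> convex (K i) \<and> compact (K i)"
    and "convex L" "closed L" "L \<inter> (\<Inter>i\<in>I. K i) = {}"
  shows "\<exists>h. (\<forall>i\<in>I. K i \<subseteq> halfspace (h i)) \<and> L \<inter> (\<Inter>i\<in>I. halfspace (h i)) = {}"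
  using assms
proof (induction I arbitrary: L rule: finite_induct)
  case empty
  then show ?case by simp
next
  case (insert i I)
  have Ki: "convex (K i)" "compact (K i)" using insert.prems(1) by auto
  have "\<exists>h. (\<forall>j\<in>I. K j \<subseteq> halfspace (h j)) \<and> (L \<inter> K i) \<inter> (\<Inter>j\<in>I. halfspace (h j)) = {}"
    by (rule insert.IH)
      (use insert.prems Ki in \<open>auto intro: convex_Int closed_Int compact_imp_closed\<close>)
  then obtain h where h: "\<forall>j\<in>I. K j \<subseteq> halfspace (h j)"
    "(L \<inter> K i) \<inter> (\<Inter>j\<in>I. halfspace (h j)) = {}" by blast
  define M where "M = L \<inter> (\<Inter>j\<in>I. halfspace (h j))"
  have M: "convex M" "closed M" "K i \<inter> M = {}"
    using h(2) insert.prems(2,3)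
    by (auto simp: M_def intro!: convex_Int closed_Int convex_INT closed_INT
        convex_halfspace closed_halfspace)
  have "\<exists>g. K i \<subseteq> halfspace g \<and> M \<inter> halfspace g = {}"
  proof (cases "K i = {}")
    case True
    have "halfspace (0::'a, -1) = {}" by (simp add: halfspace_def)
    then show ?thesis using True by blast
  next
    case False
    then obtain a b where ab: "\<forall>x\<in>K i. a \<bullet> x < b" "\<forall>x\<in>M. a \<bullet> x > b"
      using separating_hyperplane_compact_closed[OF Ki False M] by blast
    then have "K i \<subseteq> halfspace (a, b)" "M \<inter> halfspace (a, b) = {}"
      by (fastforce simp: halfspace_def)+
    then show ?thesis by blast
  qed
  then obtain g where g: "K i \<subseteq> halfspace g" "M \<inter> halfspace g = {}" by blast
  have *: "(\<Inter>j\<in>I. halfspace ((h(i := g)) j)) = (\<Inter>j\<in>I. halfspace (h j))"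
    using insert.hyps(2) by (intro INF_cong) auto
  have "L \<inter> (\<Inter>j\<in>insert i I. halfspace ((h(i := g)) j)) = {}"
    using g(2) by (simp only: INT_insert *) (auto simp: M_def)
  moreover have "\<forall>j\<in>insert i I. K j \<subseteq> halfspace ((h(i := g)) j)"
    using g(1) h(1) by auto
  ultimately show ?case by blast
qed

text \<open>Helly's theorem for tuples with repetition, so that a witness always has exactly
  \<open>DIM('a) + 1\<close> entries, even if the family has fewer distinct members.\<close>

lemma Helly_tuple:
  fixes K :: "'i \<Rightarrow> 'a::euclidean_space set"
  assumes "finite I" "\<And>i. i \<in> I \<Longrightarrow> convex (K i)" "(\<Inter>i\<in>I. K i) = {}"
  shows "\<exists>t\<in>{..DIM('a)} \<rightarrow> I. (\<Inter>k\<le>DIM('a). K (t k)) = {}"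
proof -
  have "\<exists>T. T \<subseteq> K ` I \<and> card T \<le> DIM('a) + 1 \<and> \<Inter>T = {}"
  proof (cases "card (K ` I) \<ge> DIM('a) + 1")
    case True
    show ?thesis
    proof (rule ccontr)
      assume "\<not> ?thesis"
      then have "\<Inter>T \<noteq> {}" if "T \<subseteq> K ` I" "card T = DIM('a) + 1" for T
        using that by simp
      then have "\<Inter>(K ` I) \<noteq> {}"
        by (intro Helly[OF True]) (use assms(2) in simp)
      then show False using assms(3) by simp
    qed
  next
    case False
    then show ?thesis using assms(3) by (intro exI[of _ "K ` I"]) auto
  qed
  then obtain T where T: "T \<subseteq> K ` I" "card T \<le> DIM('a) + 1" "\<Inter>T = {}" by blast
  have "finite T" using T(1) assms(1) by (rule finite_surj[rotated])
  then obtain f where f: "f ` T \<subseteq> {..DIM('a)}" "inj_on f T"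
    using card_le_inj[of T "{..DIM('a)}"] T(2) by auto
  obtain S0 where S0: "S0 \<in> T" using T(3) by blast
  \<comment> \<open>\<open>g\<close> enumerates \<open>T\<close>; positions left over repeat the
    arbitrary member \<open>S0\<close>.\<close>
  define g where "g k = (if k \<in> f ` T then inv_into T f k else S0)" for k
  have gT: "g k \<in> T" for k
    using S0 by (simp add: g_def inv_into_into)
  have gf: "g (f S) = S" if "S \<in> T" for S
    using that f(2) by (simp add: g_def)
  have "\<forall>k. \<exists>i. i \<in> I \<and> K i = g k" using gT T(1) by blast
  then obtain t where t: "\<And>k. t k \<in> I" "\<And>k. K (t k) = g k" by metis
  have "(\<Inter>k\<le>DIM('a). K (t k)) \<subseteq> \<Inter>T"
  proof
    fix x assume x: "x \<in> (\<Inter>k\<le>DIM('a). K (t k))"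
    have "x \<in> S" if "S \<in> T" for S
      using x f(1) that gf[OF that] t(2)[of "f S"] by auto
    then show "x \<in> \<Inter>T" by blast
  qed
  then show ?thesis using T(3) t(1) by blast
qed

section \<open>Counting colourings without the Tverberg property\<close>

text \<open>If the regions \<open>E g i\<close> have no common point in \<open>P\<close>, then
  \<open>g\<close> forbids some colour at every point, so at most \<open>(r - 1) ^ card P\<close>
  colourings are compatible with \<open>g\<close>.\<close>

lemma card_colourings_le:
  fixes E :: "'g \<Rightarrow> nat \<Rightarrow> 'a set"
  assumes "finite P" "finite G"
    and ex: "\<And>f. f \<in> P \<rightarrow>\<^sub>E {1..r} \<Longrightarrow>
      \<exists>g\<in>G. (\<forall>x\<in>P. x \<in> E g (f x)) \<and> P \<inter> (\<Inter>i\<in>{1..r}. E g i) = {}"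
  shows "r ^ card P \<le> card G * (r - 1) ^ card P"
proof -
  define G' where "G' = {g \<in> G. P \<inter> (\<Inter>i\<in>{1..r}. E g i) = {}}"
  define A where "A g x = {i \<in> {1..r}. x \<in> E g i}" for g x
  have fin: "finite G'" using assms(2) by (simp add: G'_def)
  have cA: "card (A g x) \<le> r - 1" if "g \<in> G'" "x \<in> P" for g x
  proof -
    have "A g x \<subset> {1..r}" using that by (fastforce simp: A_def G'_def)
    then have "card (A g x) < card {1..r}" by (rule psubset_card_mono[rotated]) simp
    then show ?thesis by simp
  qed
  have "r ^ card P = card (P \<rightarrow>\<^sub>E {1..r})"
    by (simp add: card_funcsetE[OF assms(1)])
  also have "\<dots> \<le> card (\<Union>g\<in>G'. Pi\<^sub>E P (A g))"
  proof (rule card_mono)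
    show "finite (\<Union>g\<in>G'. Pi\<^sub>E P (A g))"
      using fin assms(1) by (auto simp: A_def intro!: finite_PiE)
    show "P \<rightarrow>\<^sub>E {1..r} \<subseteq> (\<Union>g\<in>G'. Pi\<^sub>E P (A g))"
    proof
      fix f assume f: "f \<in> P \<rightarrow>\<^sub>E {1..r}"
      obtain g where "g \<in> G" "\<forall>x\<in>P. x \<in> E g (f x)" "P \<inter> (\<Inter>i\<in>{1..r}. E g i) = {}"
        using ex[OF f] by blast
      then have "g \<in> G'" "f \<in> Pi\<^sub>E P (A g)"
        using f unfolding G'_def A_def by (blast, auto simp: PiE_iff)
      then show "f \<in> (\<Union>g\<in>G'. Pi\<^sub>E P (A g))" by blast
    qed
  qed
  also have "\<dots> \<le> (\<Sum>g\<in>G'. card (Pi\<^sub>E P (A g)))"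
    by (rule card_UN_le[OF fin])
  also have "\<dots> \<le> (\<Sum>g\<in>G'. (r - 1) ^ card P)"
  proof (rule sum_mono)
    fix g assume g: "g \<in> G'"
    have "card (Pi\<^sub>E P (A g)) = (\<Prod>x\<in>P. card (A g x))"
      by (rule card_PiE[OF assms(1)])
    also have "\<dots> \<le> (\<Prod>x\<in>P. r - 1)"
      by (rule prod_mono) (use cA[OF g] in auto)
    finally show "card (Pi\<^sub>E P (A g)) \<le> (r - 1) ^ card P" by simp
  qed
  also have "\<dots> \<le> card G * (r - 1) ^ card P"
    using card_mono[OF assms(2), of G'] by (auto simp: G'_def)
  finally show ?thesis .
qed

text \<open>A pair \<open>(i, j)\<close> stands for the \<open>j\<close>-th convex piece of the \<open>i\<close>-th colour class, and
  \<open>g (t, k)\<close> is the half-space around the \<open>k\<close>-th piece of the tuple \<open>t\<close>, restricted to the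
  point set. The codes \<open>g\<close> are what is counted.\<close>

definition piece_codes :: "nat \<Rightarrow> nat \<Rightarrow> nat \<Rightarrow> ((nat \<Rightarrow> nat \<times> nat) \<times> nat) set" where
  "piece_codes D r s = ({..D} \<rightarrow>\<^sub>E {1..r} \<times> {1..s}) \<times> {..D}"

text \<open>An outer approximation of the \<open>i\<close>-th colour class that depends on the code
  alone: each piece is replaced by the intersection of all traces assigned to it.\<close>

definition code_region ::
    "nat \<Rightarrow> nat \<Rightarrow> nat \<Rightarrow> ((nat \<Rightarrow> nat \<times> nat) \<times> nat \<Rightarrow> 'a set) \<Rightarrow> nat \<Rightarrow> 'a set" where
  "code_region D r s g i =
     {x. \<exists>j\<in>{1..s}. \<forall>(t, k)\<in>piece_codes D r s. t k = (i, j) \<longrightarrow> x \<in> g (t, k)}"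

lemma card_piece_codes: "card (piece_codes D r s) = (D + 1) * (r * s) ^ (D + 1)"
  by (simp add: piece_codes_def card_cartesian_product card_funcsetE)

lemma finite_piece_codes: "finite (piece_codes D r s)"
  by (simp add: piece_codes_def finite_PiE)

lemma code_of_bad_colouring:
  fixes P :: "'a::euclidean_space set"
  assumes "finite P" and no: "\<nexists>Q. tverberg_partition r (\<lambda>_. s) P Q"
    and f: "f \<in> P \<rightarrow>\<^sub>E {1..r}"
  shows "\<exists>g\<in>piece_codes DIM('a) r s \<rightarrow>\<^sub>E halfspace_traces P.
    (\<forall>x\<in>P. x \<in> code_region DIM('a) r s g (f x)) \<and>
    P \<inter> (\<Inter>i\<in>{1..r}. code_region DIM('a) r s g i) = {}"
proof -
  let ?D = "DIM('a)"
  define Q where "Q i = {x \<in> P. f x = i}" for i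
  have "disjoint_family_on Q {1..r}" "P = (\<Union>i\<in>{1..r}. Q i)"
    using f by (auto simp: disjoint_family_on_def Q_def)
  then obtain C where C: "\<forall>i\<in>{1..r}. disjoint_convex_union s (C i) \<and> Q i \<subseteq> C i"
    and C0: "(\<Inter>i\<in>{1..r}. C i) = {}"
    using no unfolding tverberg_partition_def by blast
  have ex_B: "\<forall>i\<in>{1..r}. \<exists>B. (\<forall>j\<in>{1..s}. convex (B j)) \<and> C i = (\<Union>j\<in>{1..s}. B j)"
    using C unfolding disjoint_convex_union_def by blast
  obtain B where "\<forall>i\<in>{1..r}. (\<forall>j\<in>{1..s}. convex (B i j)) \<and> C i = (\<Union>j\<in>{1..s}. B i j)"
    by (rule exE[OF bchoice[OF ex_B]])
  then have B: "\<And>i j. i \<in> {1..r} \<Longrightarrow> j \<in> {1..s} \<Longrightarrow> convex (B i j)"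
    "\<And>i. i \<in> {1..r} \<Longrightarrow> C i = (\<Union>j\<in>{1..s}. B i j)"
    by simp_all
  \<comment> \<open>Shrinking each piece to the hull of the finitely many points it covers makes it
    compact and keeps it inside \<open>C i\<close>.\<close>
  define K where "K = (\<lambda>(i, j). convex hull (Q i \<inter> B i j))"
  have KC: "K (i, j) \<subseteq> C i" if "i \<in> {1..r}" "j \<in> {1..s}" for i j
  proof -
    have "K (i, j) \<subseteq> B i j"
      unfolding K_def using B(1)[OF that] by (simp add: hull_minimal)
    then show ?thesis using B(2)[OF that(1)] that(2) by blast
  qed
  have K: "convex (K p)" "compact (K p)" for p
    using assms(1)
    by (auto simp: K_def Q_def split: prod.split intro!: finite_imp_compact_convex_hull)
  \<comment> \<open>A tuple whose pieces do meet certifies nothing and gets the whole space as each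
    half-space.\<close>
  have "\<exists>h. (\<forall>k\<in>{..?D}. K (t k) \<subseteq> halfspace (h k)) \<and>
      ((\<Inter>k\<le>?D. K (t k)) = {} \<longrightarrow> (\<Inter>k\<le>?D. halfspace (h k)) = {})" for t
  proof (cases "(\<Inter>k\<le>?D. K (t k)) = {}")
    case True
    then show ?thesis
      using empty_Int_imp_halfspaces[of "{..?D}" "\<lambda>k. K (t k)" UNIV] K by simp
  next
    case False
    have "halfspace (0::'a, 0) = UNIV" by (simp add: halfspace_def)
    then show ?thesis using False by (intro exI[of _ "\<lambda>_. (0, 0)"]) simp
  qed
  then have ex_h: "\<forall>t. \<exists>h. (\<forall>k\<in>{..?D}. K (t k) \<subseteq> halfspace (h k)) \<and>
      ((\<Inter>k\<le>?D. K (t k)) = {} \<longrightarrow> (\<Inter>k\<le>?D. halfspace (h k)) = {})"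
    by (rule allI)
  obtain h where "\<forall>t. (\<forall>k\<in>{..?D}. K (t k) \<subseteq> halfspace (h t k)) \<and>
      ((\<Inter>k\<le>?D. K (t k)) = {} \<longrightarrow> (\<Inter>k\<le>?D. halfspace (h t k)) = {})"
    by (rule exE[OF choice[OF ex_h]])
  then have h: "\<And>t k. k \<le> ?D \<Longrightarrow> K (t k) \<subseteq> halfspace (h t k)"
    "\<And>t. (\<Inter>k\<le>?D. K (t k)) = {} \<Longrightarrow> (\<Inter>k\<le>?D. halfspace (h t k)) = {}"
    by simp_all
  define g where "g = restrict (\<lambda>(t, k). halfspace (h t k) \<inter> P) (piece_codes ?D r s)"
  have g: "g (t, k) = halfspace (h t k) \<inter> P" if "(t, k) \<in> piece_codes ?D r s" for t k
    using that by (simp add: g_def)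
  have "g \<in> piece_codes ?D r s \<rightarrow>\<^sub>E halfspace_traces P"
    by (auto simp: g_def halfspace_traces_def)
  moreover have "x \<in> code_region ?D r s g (f x)" if x: "x \<in> P" for x
  proof -
    have fx: "f x \<in> {1..r}" using f x by auto
    have "x \<in> Q (f x)" using x by (simp add: Q_def)
    then obtain j where j: "j \<in> {1..s}" "x \<in> B (f x) j"
      using C B(2)[OF fx] fx by blast
    have xK: "x \<in> K (f x, j)"
      using \<open>x \<in> Q (f x)\<close> j(2) by (simp add: K_def hull_inc)
    have "x \<in> g (t, k)" if "(t, k) \<in> piece_codes ?D r s" "t k = (f x, j)" for t k
      using h(1)[of k t] xK that x g[OF that(1)] by (auto simp: piece_codes_def)
    then show ?thesis using j(1) unfolding code_region_def by blast
  qed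
  moreover have "P \<inter> (\<Inter>i\<in>{1..r}. code_region ?D r s g i) = {}"
  proof (rule ccontr)
    assume "\<not> ?thesis"
    then obtain x where x: "x \<in> P" "\<And>i. i \<in> {1..r} \<Longrightarrow> x \<in> code_region ?D r s g i"
      by blast
    then have ex_J: "\<forall>i\<in>{1..r}. \<exists>j. j \<in> {1..s} \<and>
        (\<forall>(t, k)\<in>piece_codes ?D r s. t k = (i, j) \<longrightarrow> x \<in> g (t, k))"
      unfolding code_region_def by blast
    \<comment> \<open>A common point \<open>x\<close> of all regions selects one piece per colour.
      These pieces have no common point, so Helly yields a tuple \<open>t\<close> of them whose
      half-spaces have empty intersection, although all of them contain \<open>x\<close>.\<close>
    obtain J where "\<forall>i\<in>{1..r}. J i \<in> {1..s} \<and>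
        (\<forall>(t, k)\<in>piece_codes ?D r s. t k = (i, J i) \<longrightarrow> x \<in> g (t, k))"
      by (rule exE[OF bchoice[OF ex_J]])
    then have J: "\<And>i. i \<in> {1..r} \<Longrightarrow> J i \<in> {1..s}"
      "\<And>i t k. \<lbrakk>i \<in> {1..r}; (t, k) \<in> piece_codes ?D r s; t k = (i, J i)\<rbrakk> \<Longrightarrow> x \<in> g (t, k)"
      by fast+
    have "(\<Inter>i\<in>{1..r}. K (i, J i)) \<subseteq> (\<Inter>i\<in>{1..r}. C i)"
      by (rule INF_superset_mono[OF subset_refl KC[OF _ J(1)]])
    then have "(\<Inter>i\<in>{1..r}. K (i, J i)) = {}"
      unfolding C0 by (rule subset_empty[THEN iffD1])
    then obtain u where u: "u \<in> {..?D} \<rightarrow> {1..r}" "(\<Inter>k\<le>?D. K (u k, J (u k))) = {}"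
      using Helly_tuple[of "{1..r}" "\<lambda>i. K (i, J i)"] K(1) by auto
    define t where "t = restrict (\<lambda>k. (u k, J (u k))) {..?D}"
    have t: "(t, k) \<in> piece_codes ?D r s" if "k \<le> ?D" for k
      using that u(1) J(1) by (auto simp: piece_codes_def t_def simp del: atLeastAtMost_iff)
    have "(\<Inter>k\<le>?D. K (t k)) = {}"
      using u(2) by (simp add: t_def)
    then have "(\<Inter>k\<le>?D. halfspace (h t k)) = {}" by (rule h(2))
    moreover have "x \<in> halfspace (h t k)" if "k \<le> ?D" for k
    proof -
      have "x \<in> g (t, k)"
        by (rule J(2)[of "u k"]) (use that u(1) t in \<open>auto simp: t_def\<close>)
      then show ?thesis using g[OF t[OF that]] by simp
    qed
    ultimately show False by blast
  qed
  ultimately show ?thesis by blast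
qed

lemma power_le_if_no_tverberg_partition:
  fixes P :: "'a::euclidean_space set"
  defines "m \<equiv> DIM('a) + 1"
  assumes "finite P" "\<nexists>Q. tverberg_partition r (\<lambda>_. s) P Q"
  shows "r ^ card P \<le> ((card P + 1) ^ m) ^ (m * (r * s) ^ m) * (r - 1) ^ card P"
proof -
  let ?X = "piece_codes DIM('a) r s"
  have fin: "finite (halfspace_traces P)"
    by (rule finite_subset[of _ "Pow P"]) (use assms(2) in \<open>auto simp: halfspace_traces_def\<close>)
  have "r ^ card P \<le> card (?X \<rightarrow>\<^sub>E halfspace_traces P) * (r - 1) ^ card P"
    by (rule card_colourings_le[OF assms(2) _ code_of_bad_colouring[OF assms(2,3)]])
      (use fin finite_piece_codes in \<open>auto intro: finite_PiE\<close>)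
  also have "card (?X \<rightarrow>\<^sub>E halfspace_traces P) = card (halfspace_traces P) ^ (m * (r * s) ^ m)"
    by (simp add: card_funcsetE finite_piece_codes card_piece_codes m_def)
  also have "\<dots> \<le> ((card P + 1) ^ m) ^ (m * (r * s) ^ m)"
    using card_halfspace_traces[OF assms(2)] by (intro power_mono) (simp_all add: m_def)
  finally show ?thesis by simp
qed

section \<open>The growth rate\<close>

text \<open>After taking logarithms, \<open>n * q\<close> must exceed
  \<open>m * m * (r * s) ^ m * ln (n + 1)\<close>. For \<open>n\<close> about
  \<open>c * s ^ m * ln s\<close>, the logarithm is at most \<open>(m + 2) * ln s\<close>, so a
  large \<open>c\<close> suffices.\<close>

lemma exponential_beats_codes:
  fixes r m :: nat
  assumes "r \<ge> 2"
  shows "\<exists>c>0. \<exists>s0\<ge>1. \<forall>s\<ge>s0. \<exists>n. real n \<le> c * real s ^ m * ln (real s) \<and>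
    ((n + 1) ^ m) ^ (m * (r * s) ^ m) * (r - 1) ^ n < r ^ n"
proof -
  define q where "q = ln (real r) - ln (real (r - 1))"
  have q: "q > 0" using assms by (simp add: q_def)
  define A where "A = real m * real m * real r ^ m * (real m + 2)"
  have A: "A \<ge> 0" by (simp add: A_def)
  \<comment> \<open>The summand 1 and the factor 2 give
    \<open>(c * y - 1) * q = 2 * A * y + q * (y - 1)\<close>, which absorbs the loss from rounding
    \<open>n\<close> down.\<close>
  define c where "c = 2 * A / q + 1"
  have c: "c > 0" using A q by (simp add: c_def add_nonneg_pos)
  \<comment> \<open>The bound 3 exceeds \<open>exp 1\<close> and so gives
    \<open>ln s \<ge> 1\<close>; \<open>s \<ge> c + 1\<close> gives
    \<open>n + 1 \<le> s ^ (m + 2)\<close>.\<close>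
  define s0 where "s0 = max 3 (nat \<lceil>c\<rceil> + 1)"
  have "\<exists>n. real n \<le> c * real s ^ m * ln (real s) \<and>
      ((n + 1) ^ m) ^ (m * (r * s) ^ m) * (r - 1) ^ n < r ^ n" if s: "s \<ge> s0" for s
  proof -
    have s3: "real s \<ge> 3" and sc: "real s \<ge> c + 1"
      using s by (auto simp: s0_def) linarith
    have "exp 1 \<le> real s" using exp_le s3 by linarith
    then have ln1: "ln (real s) \<ge> 1" using s3 by (subst ln_ge_iff) auto
    define y where "y = real s ^ m * ln (real s)"
    have "1 * 1 \<le> y" unfolding y_def
      by (intro mult_mono) (use ln1 s3 in auto)
    then have y1: "y \<ge> 1" by simp
    define n where "n = nat \<lfloor>c * y\<rfloor>"
    have n: "real n \<le> c * y" "real n > c * y - 1"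
      using c y1 by (simp_all add: n_def)
    have "y \<le> real s ^ m * real s" unfolding y_def
      using ln_less_self[of "real s"] s3 by (intro mult_left_mono) (linarith, simp)
    then have "c * y \<le> c * real s ^ (m + 1)" using c by (simp add: mult.commute)
    also have "\<dots> \<le> real s ^ (m + 2) - 1"
    proof -
      have "1 * 1 \<le> (real s - c) * real s ^ (m + 1)"
        by (intro mult_mono) (use sc s3 c in \<open>auto simp: one_le_power simp del: power_Suc\<close>)
      then show ?thesis by (simp add: algebra_simps)
    qed
    finally have "real (n + 1) \<le> real s ^ (m + 2)" using n(1) by simp
    then have "ln (real (n + 1)) \<le> ln (real s ^ (m + 2))" by (subst ln_le_cancel_iff) auto
    then have lnn: "ln (real (n + 1)) \<le> (real m + 2) * ln (real s)"
      using s3 by (simp add: ln_realpow del: power_Suc power_add add_2_eq_Suc')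
    have "real m * (real m * (real r * real s) ^ m) * ln (real (n + 1)) \<le>
        real m * (real m * (real r * real s) ^ m) * ((real m + 2) * ln (real s))"
      using lnn by (intro mult_left_mono) auto
    also have "\<dots> = A * y"
      by (simp add: A_def y_def power_mult_distrib)
    also have "\<dots> \<le> (c * y - 1) * q"
    proof -
      have "(c * y - 1) * q = 2 * (A * y) + q * (y - 1)"
        using q by (simp add: c_def field_simps)
      moreover have "A * y \<ge> 0" "q * (y - 1) \<ge> 0" using A q y1 by auto
      ultimately show ?thesis by linarith
    qed
    also have "\<dots> < real n * q" using n(2) q by simp
    finally have key: "real m * (real m * (real r * real s) ^ m) * ln (real (n + 1))
        + real n * ln (real (r - 1)) < real n * ln (real r)"
      by (simp add: q_def algebra_simps)
    have "ln (real (((n + 1) ^ m) ^ (m * (r * s) ^ m) * (r - 1) ^ n)) < ln (real (r ^ n))"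
      using key assms by (simp add: ln_mult ln_realpow mult_ac del: of_nat_Suc of_nat_add)
    then have "real (((n + 1) ^ m) ^ (m * (r * s) ^ m) * (r - 1) ^ n) < real (r ^ n)"
      by (subst (asm) ln_less_cancel_iff) (use assms in auto)
    then have "((n + 1) ^ m) ^ (m * (r * s) ^ m) * (r - 1) ^ n < r ^ n"
      by (simp only: of_nat_less_iff)
    then show ?thesis using n(1) by (auto simp: y_def mult.assoc)
  qed
  moreover have "s0 \<ge> 1" by (simp add: s0_def)
  ultimately show ?thesis using c by blast
qed

text \<open>The first exponent is nondecreasing in \<open>r\<close>. At \<open>r = d + 2\<close> it
  equals \<open>d + 2 - v\<close> with \<open>v = 1 / (2 ^ d * (d + 1)) \<le> 1\<close>.\<close>

lemma exponents_ge:
  fixes r d :: nat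
  assumes "r \<ge> d + 2"
  shows "real (d + 1) \<le> (1 - 1 / (2 ^ d * (real d + 1))) * real r + 1 / 2 ^ d"
    and "real (d + 1) \<le> 2 * real d + 3 - 1 / 2 ^ r"
proof -
  define u :: real where "u = 1 / 2 ^ d"
  have u: "0 < u" "u \<le> 1" by (simp_all add: u_def)
  define v where "v = u / (real d + 1)"
  have v: "0 \<le> v" "v \<le> 1" "u = v * (real d + 1)"
    using u by (simp_all add: v_def field_simps)
  have "(1 - v) * (real d + 2) \<le> (1 - v) * real r"
    using v assms by (intro mult_left_mono) auto
  then have "real (d + 1) \<le> (1 - v) * real r + u"
    using v by (simp add: algebra_simps)
  then show "real (d + 1) \<le> (1 - 1 / (2 ^ d * (real d + 1))) * real r + 1 / 2 ^ d"
    by (simp add: u_def v_def)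
  have "1 / 2 ^ r \<le> (1::real)" by simp
  then show "real (d + 1) \<le> 2 * real d + 3 - 1 / 2 ^ r"
    unfolding of_nat_add of_nat_1 by linarith
qed

theorem theorem5p3:
  fixes r d :: nat
  assumes "CARD('d::finite) = d" and "r \<ge> d + 2"
  shows "\<exists>c::real. c > 0 \<and> (\<exists>s0::nat. \<forall>s\<ge>s0.
    ereal_of_enat (tverberg_number TYPE('d) r (\<lambda>_. s)) \<le>
      ereal (c *
        min (real s powr ((1 - 1 / (2 ^ d * (real d + 1))) * real r + 1 / 2 ^ d))
            (real s powr (2 * real d + 3 - 1 / 2 ^ r)) *
        ln (real s)))"
proof -
  have dim: "DIM(real ^ 'd) = d" using assms(1) by simp
  have "r \<ge> 2" using assms(2) by simp
  then obtain c s0 where c: "c > 0" and s0: "s0 \<ge> 1"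
    and n: "\<forall>s\<ge>s0. \<exists>n. real n \<le> c * real s ^ (d + 1) * ln (real s) \<and>
      ((n + 1) ^ (d + 1)) ^ ((d + 1) * (r * s) ^ (d + 1)) * (r - 1) ^ n < r ^ n"
    using exponential_beats_codes[of r "d + 1"] by blast
  show ?thesis
  proof (intro exI[of _ c] exI[of _ s0] conjI allI impI)
    fix s assume s: "s0 \<le> s"
    define \<mu> where "\<mu> = min (real s powr ((1 - 1 / (2 ^ d * (real d + 1))) * real r + 1 / 2 ^ d))
      (real s powr (2 * real d + 3 - 1 / 2 ^ r))"
    have s1: "real s \<ge> 1" using s s0 by simp
    obtain n where n1: "real n \<le> c * real s ^ (d + 1) * ln (real s)"
      and n2: "((n + 1) ^ (d + 1)) ^ ((d + 1) * (r * s) ^ (d + 1)) * (r - 1) ^ n < r ^ n"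
      using n s by blast
    have "\<exists>Q. tverberg_partition r (\<lambda>_. s) P Q" if "finite P" "card P = n"
      for P :: "(real ^ 'd) set"
    proof (rule ccontr)
      assume "\<not> ?thesis"
      from power_le_if_no_tverberg_partition[OF that(1) this] show False
        using n2 unfolding dim that(2) by linarith
    qed
    then have "tverberg_number TYPE('d) r (\<lambda>_. s) \<le> enat n"
      unfolding tverberg_number_def by (intro Inf_lower) blast
    then have "ereal_of_enat (tverberg_number TYPE('d) r (\<lambda>_. s)) \<le> ereal_of_enat (enat n)"
      by (simp only: ereal_of_enat_le_iff)
    also have "\<dots> = ereal (real n)" by simp
    also have "\<dots> \<le> ereal (c * \<mu> * ln (real s))"
    proof -
      have "real s ^ (d + 1) = real s powr real (d + 1)"
        using s1 by (subst powr_realpow) auto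
      \<comment> \<open>Powers of \<open>s\<close> are monotone in the exponent because
        \<open>s \<ge> 1\<close>, so both terms of the minimum dominate.\<close>
      also have "\<dots> \<le> \<mu>"
        unfolding \<mu>_def using exponents_ge[OF assms(2)] s1 by (intro min.boundedI powr_mono)
      finally have "c * real s ^ (d + 1) * ln (real s) \<le> c * \<mu> * ln (real s)"
        using c s1 by (intro mult_right_mono mult_left_mono) auto
      then show ?thesis using n1 by simp
    qed
    finally show "ereal_of_enat (tverberg_number TYPE('d) r (\<lambda>_. s)) \<le> ereal (c *
        min (real s powr ((1 - 1 / (2 ^ d * (real d + 1))) * real r + 1 / 2 ^ d))
            (real s powr (2 * real d + 3 - 1 / 2 ^ r)) * ln (real s))"
      unfolding \<mu>_def .
  qed (rule c)
qed

end
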